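(* Let $F\in\mathcal P_d$ form an $(h,\kappa,\eta,m,M)$-regular cluster and let $G=\Psi_{\kappa,h}(F)$ be its model signal. Set $\epsilon'=(1+|\kappa|)^{-2d+1}\epsilon$ and $h'=\frac{h}{1+|\kappa|}$. Then: 1. For every $\epsilon>0$, $$\Pi_{\epsilon',\frac1h}(G)\subset\bar E_\epsilon(F)\subset\Pi_{\epsilon,\frac1{h'}}(G),$$ where $$\Pi_{\epsilon',\frac1h}(G)=\left\{G'\in\mathcal P_d:|m_k(G)-m_k(G')|\le(1+|\kappa|)^{-2d+1}\epsilon\left(\tfrac1h\right)^k,\ k=0,\dots,2d-1\right\},$$ $$\Pi_{\epsilon,\frac1{h'}}(G)=\left\{G'\in\mathcal P_d:|m_k(G)-m_k(G')|\le\epsilon\left(\tfrac{1+|\kappa|}h\right)^k,\ k=0,\dots,2d-1\right\}.$$ 2. For every positive $\epsilon\le R\,h'^{\,2d-1}$ and each $q=0,\dots,2d-1$, the set $\bar E_\epsilon(F)$ is contained in the $\Delta'_q$-neighborhood of $S_{q,\epsilon,\frac1{h'}}(G)$, where $$\Delta'_q=C_4\left(\tfrac1{h'}\right)^q\epsilon .$$ Here $R,C_4>0$ are the constants, depending only on $d,\eta,m,M$, described in the context.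
   Context: Let $d\ge2$. $\mathcal P_d$ is the set of $F=(a,x)\in\mathbb R^d\times\mathbb R^d$ with $x_1<\dots<x_d$ and all $a_j\ne0$; $F$ is identified with $F(x)=\sum_j a_j\delta(x-x_j)$. Moments: $m_k(F)=\sum_{j=1}^d a_jx_j^k$. All norms are maximum norms: $\|F\|=\max(\|a\|,\|x\|)$, $\|v\|=\max_j|v_j|$. The (closed) $\Delta$-neighborhood of a set is the set of points at distance at most $\Delta$ from it in the maximum norm. Put $h(F)=\frac12(x_d-x_1)$, $\kappa(F)=\frac12(x_1+x_d)$. For $0<m\le M$ and $\eta>0$, $F$ forms an $(h,\kappa,\eta,m,M)$-regular cluster if $h=h(F)\le\frac12$, $\kappa=\kappa(F)$, $m\le|a_j|\le M$ for all $j$, and $x_{j+1}-x_j\ge\eta h$ for $j=1,\dots,d-1$. The normalization is $\Psi_{\kappa,h}(a,x)=(a,\bar x)$, $\bar x_j=\frac1h(x_j-\kappa)$; $\Psi_{\kappa(F),h(F)}(F)$ is the model signal of $F$. Error set: $E_\epsilon(F)=\{F'\in\mathcal P_d: |m_k(F')-m_k(F)|\le\epsilon,\ k=0,\dots,2d-1\}$; normalized error set: $\bar E_\epsilon(F)=\Psi_{\kappa,h}(E_\epsilon(F))$ with $\kappa=\kappa(F)$, $h=h(F)$. For $G\in\mathcal P_d$, $\epsilon,\alpha>0$ and $0\le q\le 2d-1$: $S_q(G)$ is the set of $(a,x)\in\mathbb R^d\times\mathbb R^d$ with $\sum_j a_jx_j^k=m_k(G)$ for $k=0,\dots,q$, and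 $S_{q,\epsilon,\alpha}(G)$ is the set of signals $G'\in S_q(G)\cap\mathcal P_d$ with $|m_k(G')-m_k(G)|\le\epsilon\alpha^k$ for $k=q+1,\dots,2d-1$. Constants: let $PM:\mathcal P_d\to\mathbb R^{2d}$, $PM(F)=(m_0(F),\dots,m_{2d-1}(F))$, and $Q_R(\nu)=\{\nu':\|\nu'-\nu\|\le R\}$. A signal in $\mathcal P_d$ is $(\eta,m,M)$-regular if its nodes lie in $[-1,1]$, neighboring nodes are at distance at least $\eta$, and its amplitudes satisfy $m\le|a_j|\le M$. The positive constants $R,C_3,C_4$, depending only on $d,\eta,m,M$, are such that for every $(\eta,m,M)$-regular $G$ with $\nu=PM(G)$, the inverse $PM^{-1}$ exists on $Q_R(\nu)$, is a diffeomorphism of $Q_R(\nu)$ onto $PM^{-1}(Q_R(\nu))$, and $C_3\|\nu''-\nu'\|\le\|PM^{-1}(\nu'')-PM^{-1}(\nu')\|\le C_4\|\nu''-\nu'\|$ for all $\nu',\nu''\in Q_R(\nu)$ (such constants exist). *)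

theory Defs
  imports "HOL-Analysis.Analysis"
begin

text \<open>
  The number of nodes is \<open>d = CARD('n)\<close>, where \<open>'n\<close> is a finite linearly ordered index type. A pair
  \<open>(a, x)\<close> consists of the amplitudes \<open>a\<close> and the nodes \<open>x\<close>. The maximum norm is \<open>infnorm\<close>; on the
  product space it is the maximum of the norms of \<open>a\<close> and \<open>x\<close>.
\<close>

type_synonym 'n signal = "(real ^ 'n) \<times> (real ^ 'n)"

definition signals :: "('n::{finite,linorder}) signal set" where
  "signals = {(a, x). (\<forall>i j. i < j \<longrightarrow> x $ i < x $ j) \<and> (\<forall>j. a $ j \<noteq> 0)}"

definition moment :: "nat \<Rightarrow> ('n::finite) signal \<Rightarrow> real" where
  "moment k F = (\<Sum>j\<in>UNIV. fst F $ j * (snd F $ j) ^ k)"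

definition half_width :: "('n::{finite,linorder}) signal \<Rightarrow> real" where
  "half_width F = (snd F $ Max UNIV - snd F $ Min UNIV) / 2"

definition center :: "('n::{finite,linorder}) signal \<Rightarrow> real" where
  "center F = (snd F $ Min UNIV + snd F $ Max UNIV) / 2"

definition neighbors :: "'n::linorder \<Rightarrow> 'n \<Rightarrow> bool" where
  "neighbors i j \<longleftrightarrow> i < j \<and> \<not> (\<exists>k. i < k \<and> k < j)"

definition regular_cluster ::
    "real \<Rightarrow> real \<Rightarrow> real \<Rightarrow> real \<Rightarrow> real \<Rightarrow> ('n::{finite,linorder}) signal \<Rightarrow> bool" where
  "regular_cluster h \<kappa> \<eta> m M F \<longleftrightarrow>
     h = half_width F \<and> h \<le> 1 / 2 \<and> \<kappa> = center F \<and>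
     (\<forall>j. m \<le> \<bar>fst F $ j\<bar> \<and> \<bar>fst F $ j\<bar> \<le> M) \<and>
     (\<forall>i j. neighbors i j \<longrightarrow> snd F $ j - snd F $ i \<ge> \<eta> * h)"

definition normalize_signal :: "real \<Rightarrow> real \<Rightarrow> ('n::finite) signal \<Rightarrow> 'n signal" where
  "normalize_signal \<kappa> h F = (fst F, \<chi> j. 1 / h * (snd F $ j - \<kappa>))"

definition error_set :: "real \<Rightarrow> ('n::{finite,linorder}) signal \<Rightarrow> 'n signal set" where
  "error_set \<epsilon> F =
     {F' \<in> signals. \<forall>k \<le> 2 * CARD('n) - 1. \<bar>moment k F' - moment k F\<bar> \<le> \<epsilon>}"

definition normalized_error_set :: "real \<Rightarrow> ('n::{finite,linorder}) signal \<Rightarrow> 'n signal set" where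
  "normalized_error_set \<epsilon> F = normalize_signal (center F) (half_width F) ` error_set \<epsilon> F"

definition moment_box ::
    "real \<Rightarrow> real \<Rightarrow> ('n::{finite,linorder}) signal \<Rightarrow> 'n signal set" where
  "moment_box \<epsilon> \<alpha> G =
     {G' \<in> signals. \<forall>k \<le> 2 * CARD('n) - 1. \<bar>moment k G - moment k G'\<bar> \<le> \<epsilon> * \<alpha> ^ k}"

definition prony_variety :: "nat \<Rightarrow> ('n::finite) signal \<Rightarrow> 'n signal set" where
  "prony_variety q G = {F. \<forall>k \<le> q. moment k F = moment k G}"

definition prony_variety_part ::
    "nat \<Rightarrow> real \<Rightarrow> real \<Rightarrow> ('n::{finite,linorder}) signal \<Rightarrow> 'n signal set" where
  "prony_variety_part q \<epsilon> \<alpha> G =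
     {G' \<in> prony_variety q G \<inter> signals.
        \<forall>k \<in> {q + 1 .. 2 * CARD('n) - 1}. \<bar>moment k G' - moment k G\<bar> \<le> \<epsilon> * \<alpha> ^ k}"

text \<open>
  The distance of a point to a nonempty set is the infimum of the distances to its points;
  the neighborhood of the empty set is empty (\<open>Inf {}\<close> is unspecified on the reals).
\<close>

definition closed_neighborhood :: "real \<Rightarrow> 'a::euclidean_space set \<Rightarrow> 'a set" where
  "closed_neighborhood \<Delta> S = {z. S \<noteq> {} \<and> (INF y\<in>S. infnorm (z - y)) \<le> \<Delta>}"

text \<open>
  The index type \<open>'n bit0\<close> has \<open>2 * CARD('n)\<close> elements, so \<open>real ^ 'n bit0\<close> is the
  \<open>2d\<close>-dimensional moment space. The coordinate with index \<open>i\<close> is the moment whose order is the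
  position (counted from \<open>0\<close>) of \<open>i\<close> in the linear order of \<open>'n bit0\<close>.
\<close>

definition prony_map :: "('n::finite) signal \<Rightarrow> real ^ 'n bit0" where
  "prony_map F = (\<chi> i. moment (card {..<i}) F)"

definition cube :: "real \<Rightarrow> 'a::euclidean_space \<Rightarrow> 'a set" where
  "cube R \<nu> = {\<nu>'. infnorm (\<nu>' - \<nu>) \<le> R}"

definition prony_inverse :: "real ^ ('n::{finite,linorder}) bit0 \<Rightarrow> 'n signal" where
  "prony_inverse = inv_into signals prony_map"

definition regular_signal ::
    "real \<Rightarrow> real \<Rightarrow> real \<Rightarrow> ('n::{finite,linorder}) signal \<Rightarrow> bool" where
  "regular_signal \<eta> m M G \<longleftrightarrow>
     G \<in> signals \<and>
     (\<forall>j. snd G $ j \<in> {-1..1}) \<and>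
     (\<forall>i j. neighbors i j \<longrightarrow> snd G $ j - snd G $ i \<ge> \<eta>) \<and>
     (\<forall>j. m \<le> \<bar>fst G $ j\<bar> \<and> \<bar>fst G $ j\<bar> \<le> M)"

text \<open>\<open>C_on k f U\<close>: all iterated directional derivatives of \<open>f\<close> up to order \<open>k\<close> exist and are
  continuous on the open set \<open>U\<close>.\<close>

primrec C_on :: "nat \<Rightarrow> ('a::euclidean_space \<Rightarrow> 'b::euclidean_space) \<Rightarrow> 'a set \<Rightarrow> bool" where
  "C_on 0 f U \<longleftrightarrow> continuous_on U f"
| "C_on (Suc k) f U \<longleftrightarrow>
     (\<forall>x\<in>U. f differentiable (at x)) \<and>
     (\<forall>v. C_on k (\<lambda>x. frechet_derivative f (at x) v) U)"

text \<open>On a set that need not be open, smoothness means having a smooth extension to an open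
  neighborhood.\<close>

definition smooth_on :: "('a::euclidean_space \<Rightarrow> 'b::euclidean_space) \<Rightarrow> 'a set \<Rightarrow> bool" where
  "smooth_on f A \<longleftrightarrow>
     (\<exists>U g. open U \<and> A \<subseteq> U \<and> (\<forall>x\<in>A. g x = f x) \<and> (\<forall>k. C_on k g U))"

definition diffeomorphism ::
    "'a::euclidean_space set \<Rightarrow> 'b::euclidean_space set \<Rightarrow> ('a \<Rightarrow> 'b) \<Rightarrow> bool" where
  "diffeomorphism A B f \<longleftrightarrow>
     bij_betw f A B \<and> smooth_on f A \<and> smooth_on (inv_into A f) B"

text \<open>
  The admissible constants; they depend on the dimension \<open>CARD('n)\<close> and on \<open>\<eta>\<close>, \<open>m\<close>, \<open>M\<close> only. The
  first clause for \<open>G\<close> says that the inverse of the Prony map exists on the whole cube; there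
  \<open>prony_inverse\<close> agrees with it.
\<close>

definition prony_constants ::
    "('n::{finite,linorder}) itself \<Rightarrow> real \<Rightarrow> real \<Rightarrow> real \<Rightarrow> real \<Rightarrow> real \<Rightarrow> real \<Rightarrow> bool" where
  "prony_constants _ \<eta> m M R C\<^sub>3 C\<^sub>4 \<longleftrightarrow>
     0 < R \<and> 0 < C\<^sub>3 \<and> 0 < C\<^sub>4 \<and>
     (\<forall>G :: 'n signal. regular_signal \<eta> m M G \<longrightarrow>
        (let Q = cube R (prony_map G) in
          (\<forall>\<nu>'\<in>Q. \<exists>!F. F \<in> signals \<and> prony_map F = \<nu>') \<and>
          diffeomorphism Q {F :: 'n signal. F \<in> signals \<and> prony_map F \<in> Q} prony_inverse \<and>
          (\<forall>\<nu>'\<in>Q. \<forall>\<nu>''\<in>Q.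
             C\<^sub>3 * infnorm (\<nu>'' - \<nu>')
               \<le> infnorm (prony_inverse \<nu>'' - prony_inverse \<nu>' :: 'n signal) \<and>
             infnorm (prony_inverse \<nu>'' - prony_inverse \<nu>' :: 'n signal)
               \<le> C\<^sub>4 * infnorm (\<nu>'' - \<nu>'))))"

end

theory Submission
  imports Defs
begin

text \<open>
  Moments of an affinely transformed signal are binomial combinations of the original moments, so a
  geometric bound \<open>\<delta> \<alpha>\<^sup>k\<close> on moment differences turns into \<open>\<delta> (\<bar>c\<bar> \<alpha> + \<bar>t\<bar>)\<^sup>k\<close> under \<open>x \<mapsto> c x + t\<close>. Applied to
  the normalization and to its inverse this gives both inclusions of the first part. For the second
  part, replace the first \<open>q + 1\<close> moments of a point \<open>G'\<close> of the error set by those of \<open>G\<close>. The preimage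
  of the resulting vector under the Prony map lies on the Prony variety, and the Lipschitz bound on
  the inverse controls its distance to \<open>G'\<close>.
\<close>

section \<open>Moments under affine changes of the nodes\<close>

definition affine_signal :: "real \<Rightarrow> real \<Rightarrow> ('n::finite) signal \<Rightarrow> 'n signal" where
  "affine_signal c t F = (fst F, \<chi> j. c * snd F $ j + t)"

lemma moment_affine_signal:
  "moment k (affine_signal c t F) = (\<Sum>l\<le>k. of_nat (k choose l) * c ^ l * t ^ (k - l) * moment l F)"
proof -
  have "moment k (affine_signal c t F)
      = (\<Sum>j\<in>UNIV. \<Sum>l\<le>k. of_nat (k choose l) * c ^ l * t ^ (k - l) * (fst F $ j * (snd F $ j) ^ l))"
    by (simp add: moment_def affine_signal_def binomial_ring power_mult_distrib sum_distrib_left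
        mult_ac)
  also have "\<dots> = (\<Sum>l\<le>k. \<Sum>j\<in>UNIV. of_nat (k choose l) * c ^ l * t ^ (k - l)
      * (fst F $ j * (snd F $ j) ^ l))"
    by (rule sum.swap)
  also have "\<dots> = (\<Sum>l\<le>k. of_nat (k choose l) * c ^ l * t ^ (k - l) * moment l F)"
    by (simp add: moment_def sum_distrib_left)
  finally show ?thesis .
qed

text \<open>Termwise estimates of the binomial expansion resum, again by the binomial theorem, to a
  single power. This is why the bounds are taken geometric in the order.\<close>

lemma moment_affine_signal_diff_le:
  assumes "\<And>l. l \<le> k \<Longrightarrow> \<bar>moment l F' - moment l F\<bar> \<le> \<delta> * \<alpha> ^ l"
  shows "\<bar>moment k (affine_signal c t F') - moment k (affine_signal c t F)\<bar>
    \<le> \<delta> * (\<bar>c\<bar> * \<alpha> + \<bar>t\<bar>) ^ k"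
proof -
  have "\<bar>moment k (affine_signal c t F') - moment k (affine_signal c t F)\<bar>
      = \<bar>\<Sum>l\<le>k. of_nat (k choose l) * c ^ l * t ^ (k - l) * (moment l F' - moment l F)\<bar>"
    by (simp add: moment_affine_signal sum_subtractf right_diff_distrib)
  also have "\<dots> \<le> (\<Sum>l\<le>k. of_nat (k choose l) * \<bar>c\<bar> ^ l * \<bar>t\<bar> ^ (k - l)
      * \<bar>moment l F' - moment l F\<bar>)"
    by (rule order_trans[OF sum_abs]) (simp add: abs_mult power_abs)
  also have "\<dots> \<le> (\<Sum>l\<le>k. of_nat (k choose l) * \<bar>c\<bar> ^ l * \<bar>t\<bar> ^ (k - l) * (\<delta> * \<alpha> ^ l))"
    by (intro sum_mono mult_left_mono assms) auto
  also have "\<dots> = \<delta> * (\<bar>c\<bar> * \<alpha> + \<bar>t\<bar>) ^ k"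
    by (simp add: binomial_ring power_mult_distrib sum_distrib_left mult_ac)
  finally show ?thesis .
qed

lemma affine_signal_in_signals:
  assumes "F \<in> signals" and "c > 0"
  shows "affine_signal c t F \<in> signals"
  using assms by (auto simp: signals_def affine_signal_def)

text \<open>With the two inverse identities that follow, normalization and its inverse both become
  instances of \<open>affine_signal\<close>, so one moment estimate serves both inclusions.\<close>

lemma normalize_signal_eq_affine:
  "normalize_signal \<kappa> h F = affine_signal (1 / h) (- \<kappa> / h) F"
  by (simp add: normalize_signal_def affine_signal_def vec_eq_iff diff_divide_distrib)

lemma normalize_affine_signal:
  assumes "h \<noteq> 0"
  shows "normalize_signal \<kappa> h (affine_signal h \<kappa> F) = F"
  using assms by (simp add: normalize_signal_def affine_signal_def vec_eq_iff prod_eq_iff)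

lemma affine_normalize_signal:
  assumes "h \<noteq> 0"
  shows "affine_signal h \<kappa> (normalize_signal \<kappa> h F) = F"
  using assms by (simp add: normalize_signal_def affine_signal_def vec_eq_iff prod_eq_iff)

section \<open>Regularity of the model signal\<close>

lemma half_width_pos:
  fixes F :: "('n::{finite,linorder}) signal"
  assumes "F \<in> signals" and "2 \<le> CARD('n)"
  shows "half_width F > 0"
proof -
  have "(Min UNIV :: 'n) \<noteq> Max UNIV"
  proof
    assume eq: "(Min UNIV :: 'n) = Max UNIV"
    \<comment> \<open>Every index lies between the minimum and the maximum, so their equality would
      leave a single node.\<close>
    have "i = j" for i j :: 'n
      using Min_le[of UNIV i] Max_ge[of UNIV i] Min_le[of UNIV j] Max_ge[of UNIV j] eq
      by (metis UNIV_I finite antisym)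
    then have "CARD('n) \<le> 1"
      by (metis (full_types) card_le_Suc0_iff_eq finite One_nat_def)
    with assms(2) show False by simp
  qed
  then have "(Min UNIV :: 'n) < Max UNIV"
    by (simp add: order_less_le)
  with assms(1) show ?thesis
    by (auto simp: signals_def half_width_def)
qed

text \<open>The extreme nodes are \<kappa> - h and \<kappa> + h. Normalization sends them to -1 and
  1 and divides all gaps by h.\<close>

lemma regular_signal_normalize:
  fixes F :: "('n::{finite,linorder}) signal"
  assumes F: "F \<in> signals" and reg: "regular_cluster h \<kappa> \<eta> m M F" and "h > 0"
  shows "regular_signal \<eta> m M (normalize_signal \<kappa> h F)"
proof -
  have mono: "snd F $ i \<le> snd F $ j" if "i \<le> j" for i j
    using F that by (cases "i = j") (auto simp: signals_def order_le_less)
  have lo: "\<kappa> - h = snd F $ Min UNIV" and hi: "\<kappa> + h = snd F $ Max UNIV"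
    using reg by (simp_all add: regular_cluster_def half_width_def center_def field_simps)
  have "- h \<le> snd F $ j - \<kappa>" "snd F $ j - \<kappa> \<le> h" for j
    using mono[of "Min UNIV" j] mono[of j "Max UNIV"] lo hi by auto
  moreover have "normalize_signal \<kappa> h F \<in> signals"
    unfolding normalize_signal_eq_affine by (rule affine_signal_in_signals) (use F \<open>h > 0\<close> in auto)
  moreover have "\<eta> \<le> snd (normalize_signal \<kappa> h F) $ j - snd (normalize_signal \<kappa> h F) $ i"
    if "neighbors i j" for i j
  proof -
    have "\<eta> * h \<le> snd F $ j - snd F $ i"
      using reg that unfolding regular_cluster_def by blast
    with \<open>h > 0\<close> show ?thesis
      by (simp add: normalize_signal_def pos_le_divide_eq flip: diff_divide_distrib)
  qed
  ultimately show ?thesis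
    using reg \<open>h > 0\<close>
    by (auto simp: regular_signal_def regular_cluster_def normalize_signal_def pos_divide_le_eq
        pos_le_divide_eq)
qed

section \<open>Moment coordinates and the maximum norm\<close>

text \<open>For the index type \<open>'n bit0\<close> this says that \<open>prony_map\<close> lists
  each moment of order below 2d exactly once.\<close>

lemma bij_betw_card_lessThan:
  "bij_betw (\<lambda>i::'a::{finite,linorder}. card {..<i}) UNIV {..<CARD('a)}"
proof -
  have "card {..<i} < card {..<j}" if "i < j" for i j :: 'a
    by (rule psubset_card_mono) (use that in auto)
  then have inj: "inj (\<lambda>i::'a. card {..<i})"
    by (intro linorder_injI) (metis less_irrefl)
  moreover have "card {..<i} < CARD('a)" for i :: 'a
    by (rule psubset_card_mono) auto
  ultimately show ?thesis
    by (intro bij_betw_imageI card_subset_eq) (auto simp: card_image)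
qed

lemma infnorm_vec_le_iff:
  fixes v :: "real ^ 'k"
  shows "infnorm v \<le> B \<longleftrightarrow> (\<forall>i. \<bar>v $ i\<bar> \<le> B)"
proof -
  have *: "{\<bar>v \<bullet> b\<bar> |b. b \<in> Basis} = range (\<lambda>i. \<bar>v $ i\<bar>)"
    by (auto simp: Basis_vec_def inner_axis) (metis inner_axis inner_real_def mult.right_neutral)
  show ?thesis
    unfolding infnorm_def * by (subst cSup_le_iff) auto
qed

lemma mem_cube_iff: "\<nu>' \<in> cube R \<nu> \<longleftrightarrow> (\<forall>i. \<bar>\<nu>' $ i - \<nu> $ i\<bar> \<le> R)"
  for \<nu> :: "real ^ 'k"
  by (simp add: cube_def infnorm_vec_le_iff)

text \<open>The distance to a set is an infimum of numbers bounded below by 0, so one near point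
  suffices.\<close>

lemma mem_closed_neighborhood:
  assumes "y \<in> S" and "infnorm (z - y) \<le> \<Delta>"
  shows "z \<in> closed_neighborhood \<Delta> S"
proof -
  have "(INF y\<in>S. infnorm (z - y)) \<le> infnorm (z - y)"
    using assms(1) by (intro cINF_lower bdd_belowI2[where m = 0]) (auto simp: infnorm_pos_le)
  then show ?thesis
    using assms by (auto simp: closed_neighborhood_def)
qed

section \<open>The two inclusions for the normalized error set\<close>

text \<open>Undoing the normalization turns the ratio 1/h into 1 + |\<kappa>|. This base is at least
  1, so the order 2d - 1 is the worst one, and the factor in \<open>\<epsilon>'\<close> is the
  reciprocal of its power.\<close>

lemma moment_box_subset_normalized_error_set:
  fixes F :: "('n::{finite,linorder}) signal"
  assumes h: "half_width F > 0" and "\<epsilon> \<ge> 0"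
    and eps': "\<epsilon>' = (1 + \<bar>center F\<bar>) powi (- 2 * int CARD('n) + 1) * \<epsilon>"
  shows "moment_box \<epsilon>' (1 / half_width F) (normalize_signal (center F) (half_width F) F)
    \<subseteq> normalized_error_set \<epsilon> F"
proof
  let ?h = "half_width F" and ?\<kappa> = "center F" and ?N = "2 * CARD('n) - 1"
  fix G' assume G': "G' \<in> moment_box \<epsilon>' (1 / ?h) (normalize_signal ?\<kappa> ?h F)"
  define F' where "F' = affine_signal ?h ?\<kappa> G'"
  have "- 2 * int CARD('n) + 1 = - int ?N"
    by (simp add: Suc_le_eq)
  then have eps: "\<epsilon>' * (1 + \<bar>?\<kappa>\<bar>) ^ ?N = \<epsilon>"
    unfolding eps' by (simp only: power_int_minus power_int_of_nat) simp
  have "\<epsilon>' \<ge> 0"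
    unfolding eps' using \<open>\<epsilon> \<ge> 0\<close> by simp
  have "\<bar>moment k F' - moment k F\<bar> \<le> \<epsilon>" if k: "k \<le> ?N" for k
  proof -
    have "\<bar>moment k F' - moment k F\<bar> \<le> \<epsilon>' * (\<bar>?h\<bar> * (1 / ?h) + \<bar>?\<kappa>\<bar>) ^ k"
      using moment_affine_signal_diff_le[of k G' "normalize_signal ?\<kappa> ?h F" \<epsilon>' "1 / ?h" ?h ?\<kappa>]
        G' k h
      by (auto simp: F'_def affine_normalize_signal moment_box_def abs_minus_commute)
    also have "\<dots> = \<epsilon>' * (1 + \<bar>?\<kappa>\<bar>) ^ k"
      using h by simp
    also have "\<dots> \<le> \<epsilon>' * (1 + \<bar>?\<kappa>\<bar>) ^ ?N"
      using k \<open>\<epsilon>' \<ge> 0\<close> by (intro mult_left_mono power_increasing) auto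
    finally show ?thesis
      using eps by simp
  qed
  moreover have "F' \<in> signals"
    using G' h by (simp add: F'_def affine_signal_in_signals moment_box_def)
  ultimately have "F' \<in> error_set \<epsilon> F"
    by (simp add: error_set_def)
  moreover have "G' = normalize_signal ?\<kappa> ?h F'"
    using h by (simp add: F'_def normalize_affine_signal)
  ultimately show "G' \<in> normalized_error_set \<epsilon> F"
    by (auto simp: normalized_error_set_def)
qed

lemma normalized_error_set_subset_moment_box:
  fixes F :: "('n::{finite,linorder}) signal"
  assumes h: "half_width F > 0"
  shows "normalized_error_set \<epsilon> F
    \<subseteq> moment_box \<epsilon> ((1 + \<bar>center F\<bar>) / half_width F)
        (normalize_signal (center F) (half_width F) F)"
proof
  let ?h = "half_width F" and ?\<kappa> = "center F" and ?N = "2 * CARD('n) - 1"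
  fix G' assume "G' \<in> normalized_error_set \<epsilon> F"
  then obtain F' where F': "F' \<in> error_set \<epsilon> F" and G': "G' = normalize_signal ?\<kappa> ?h F'"
    by (auto simp: normalized_error_set_def)
  have "\<bar>moment k (normalize_signal ?\<kappa> ?h F) - moment k G'\<bar> \<le> \<epsilon> * ((1 + \<bar>?\<kappa>\<bar>) / ?h) ^ k"
    if k: "k \<le> ?N" for k
  proof -
    \<comment> \<open>The constant bound is written with ratio 1, so the affine estimate yields the
      ratio 1/h + |\<kappa>|/h.\<close>
    have "\<bar>moment l F' - moment l F\<bar> \<le> \<epsilon> * 1 ^ l" if "l \<le> k" for l
      using F' k that by (simp add: error_set_def)
    from moment_affine_signal_diff_le[OF this, where c = "1 / ?h" and t = "- ?\<kappa> / ?h"]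
    show ?thesis
      using h by (simp add: G' normalize_signal_eq_affine abs_minus_commute add_divide_distrib)
  qed
  moreover have "G' \<in> signals"
    using F' h by (auto simp: G' normalize_signal_eq_affine error_set_def affine_signal_in_signals)
  ultimately show "G' \<in> moment_box \<epsilon> ((1 + \<bar>?\<kappa>\<bar>) / ?h) (normalize_signal ?\<kappa> ?h F)"
    by (simp add: moment_box_def)
qed

section \<open>Distance to the Prony variety\<close>

text \<open>Since \<alpha> is at least 1, the bound on \<epsilon> puts all moment vectors of the box
  into the cube where the inverse is Lipschitz.\<close>

lemma moment_box_subset_neighborhood:
  fixes G :: "('n::{finite,linorder}) signal"
  assumes const: "prony_constants TYPE('n) \<eta> m M R C\<^sub>3 C\<^sub>4"
    and reg: "regular_signal \<eta> m M G"
    and \<alpha>: "1 \<le> \<alpha>" and eps: "0 \<le> \<epsilon>" "\<epsilon> * \<alpha> ^ (2 * CARD('n) - 1) \<le> R"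
    and q: "q \<le> 2 * CARD('n) - 1"
  shows "moment_box \<epsilon> \<alpha> G \<subseteq> closed_neighborhood (C\<^sub>4 * \<alpha> ^ q * \<epsilon>) (prony_variety_part q \<epsilon> \<alpha> G)"
proof
  let ?N = "2 * CARD('n) - 1" and ?Q = "cube R (prony_map G)"
  let ?ord = "\<lambda>i :: 'n bit0. card {..<i}"
  fix G' assume G': "G' \<in> moment_box \<epsilon> \<alpha> G"
  then have diff: "\<bar>moment k G' - moment k G\<bar> \<le> \<epsilon> * \<alpha> ^ k" if "k \<le> ?N" for k
    using that by (simp add: moment_box_def abs_minus_commute)
  have bij: "bij_betw ?ord UNIV {..?N}"
  proof -
    have "CARD('n bit0) = Suc ?N"
      using zero_less_card_finite[where 'a = 'n] unfolding card_bit0 by linarith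
    then show ?thesis
      using bij_betw_card_lessThan[where 'a = "'n bit0"] by (simp only: lessThan_Suc_atMost)
  qed
  then have ord_le: "?ord i \<le> ?N" for i
    by (auto dest: bij_betwE)
  have ord_surj: "\<exists>i. ?ord i = k" if "k \<le> ?N" for k
    using bij that unfolding bij_betw_def by (metis (no_types, lifting) atMost_iff imageE)
  have bound: "\<epsilon> * \<alpha> ^ k \<le> \<epsilon> * \<alpha> ^ n" if "k \<le> n" for k n
    using that \<alpha> eps by (intro mult_left_mono power_increasing) auto
  have diff_R: "\<bar>moment k G' - moment k G\<bar> \<le> R" if "k \<le> ?N" for k
    using diff[OF that] bound[OF that] eps by linarith
  have "R > 0" and "C\<^sub>4 > 0"
    using const by (auto simp: prony_constants_def)
  have unique: "\<exists>!F. F \<in> signals \<and> prony_map F = \<nu>'" if "\<nu>' \<in> ?Q" for \<nu>'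
    using const reg that unfolding prony_constants_def Let_def by blast
  have lip: "infnorm (prony_inverse \<nu>'' - prony_inverse \<nu>' :: 'n signal) \<le> C\<^sub>4 * infnorm (\<nu>'' - \<nu>')"
    if "\<nu>' \<in> ?Q" "\<nu>'' \<in> ?Q" for \<nu>' \<nu>''
    using const reg that unfolding prony_constants_def Let_def by blast
  \<comment> \<open>Each coordinate differs from that of G by 0 or by a moment error of
    \<open>G'\<close>, so this vector stays in the cube.\<close>
  define \<nu> where "\<nu> = (\<chi> i. moment (?ord i) (if ?ord i \<le> q then G else G'))"
  have Q: "prony_map G' \<in> ?Q" "\<nu> \<in> ?Q"
    using diff_R[OF ord_le] \<open>R > 0\<close> by (auto simp: mem_cube_iff prony_map_def \<nu>_def)
  obtain G'' where G'': "G'' \<in> signals" "prony_map G'' = \<nu>"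
    using unique[OF Q(2)] by auto
  \<comment> \<open>\<open>inv_into\<close> picks some preimage; uniqueness over the cube identifies
    it with H.\<close>
  have inv: "prony_inverse (prony_map H) = H" if "H \<in> signals" "prony_map H \<in> ?Q" for H
  proof -
    have ex: "prony_map H \<in> prony_map ` signals"
      using that by auto
    show ?thesis
      using unique[OF that(2)] that(1) inv_into_into[OF ex] f_inv_into_f[OF ex]
      unfolding prony_inverse_def by blast
  qed
  have mom: "moment k G'' = moment k (if k \<le> q then G else G')" if "k \<le> ?N" for k
  proof -
    obtain i where "?ord i = k"
      using ord_surj[OF \<open>k \<le> ?N\<close>] by auto
    moreover have "prony_map G'' $ i = \<nu> $ i"
      using G'' by simp
    ultimately show ?thesis
      by (simp add: prony_map_def \<nu>_def)
  qed
  have "G'' \<in> prony_variety_part q \<epsilon> \<alpha> G"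
    using mom diff q G''(1) by (auto simp: prony_variety_part_def prony_variety_def)
  moreover have "infnorm (G' - G'') \<le> C\<^sub>4 * \<alpha> ^ q * \<epsilon>"
  proof -
    \<comment> \<open>Only orders up to q were replaced; the others cancel. Hence the exponent is q
      and not 2d - 1.\<close>
    have "\<bar>moment (?ord i) G' - moment (?ord i) G\<bar> \<le> \<epsilon> * \<alpha> ^ q" if "?ord i \<le> q" for i
      using diff[OF ord_le] bound[OF that] by (rule order_trans)
    then have "infnorm (prony_map G' - \<nu>) \<le> \<epsilon> * \<alpha> ^ q"
      using \<alpha> eps by (auto simp: infnorm_vec_le_iff prony_map_def \<nu>_def)
    moreover have "infnorm (G' - G'') \<le> C\<^sub>4 * infnorm (prony_map G' - \<nu>)"
      using lip[OF Q(2) Q(1)] inv[of G'] inv[of G''] Q G'' G' by (simp add: moment_box_def)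
    ultimately show ?thesis
      using \<open>C\<^sub>4 > 0\<close> by (smt (verit) mult_left_mono mult.assoc mult.commute)
  qed
  ultimately show "G' \<in> closed_neighborhood (C\<^sub>4 * \<alpha> ^ q * \<epsilon>) (prony_variety_part q \<epsilon> \<alpha> G)"
    by (rule mem_closed_neighborhood)
qed

section \<open>Assembly\<close>

theorem theorem5p2:
  fixes F G :: "('n::{finite,linorder}) signal"
    and h \<kappa> \<eta> m M h' :: real
  assumes "2 \<le> CARD('n)"
    and "0 < m" and "m \<le> M" and "0 < \<eta>"
    and "F \<in> signals"
    and "regular_cluster h \<kappa> \<eta> m M F"
    and "G = normalize_signal \<kappa> h F"
    and "h' = h / (1 + \<bar>\<kappa>\<bar>)"
  shows "(\<forall>\<epsilon>>0. \<forall>\<epsilon>'. \<epsilon>' = (1 + \<bar>\<kappa>\<bar>) powi (- 2 * int CARD('n) + 1) * \<epsilon> \<longrightarrow>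
            moment_box \<epsilon>' (1 / h) G \<subseteq> normalized_error_set \<epsilon> F \<and>
            normalized_error_set \<epsilon> F \<subseteq> moment_box \<epsilon> (1 / h') G)
       \<and> (\<forall>R C\<^sub>3 C\<^sub>4. prony_constants TYPE('n) \<eta> m M R C\<^sub>3 C\<^sub>4 \<longrightarrow>
            (\<forall>\<epsilon>. 0 < \<epsilon> \<and> \<epsilon> \<le> R * h' ^ (2 * CARD('n) - 1) \<longrightarrow>
              (\<forall>q \<le> 2 * CARD('n) - 1.
                normalized_error_set \<epsilon> F
                  \<subseteq> closed_neighborhood (C\<^sub>4 * (1 / h') ^ q * \<epsilon>)
                      (prony_variety_part q \<epsilon> (1 / h') G))))"
proof -
  have h: "h = half_width F" and \<kappa>: "\<kappa> = center F" and "h \<le> 1 / 2"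
    using assms(6) by (auto simp: regular_cluster_def)
  have "h > 0"
    using half_width_pos assms(1,5) h by blast
  have reg: "regular_signal \<eta> m M G"
    using regular_signal_normalize assms(5-7) \<open>h > 0\<close> by blast
  have inv_h': "1 / h' = (1 + \<bar>\<kappa>\<bar>) / h"
    using assms(8) by simp
  have "h' > 0"
    using assms(8) \<open>h > 0\<close> by simp
  \<comment> \<open>The cluster condition h \<le> 1/2 makes the powers of the ratio nondecreasing in
    the order.\<close>
  have "1 \<le> 1 / h'"
    using \<open>h > 0\<close> \<open>h \<le> 1 / 2\<close> unfolding inv_h' by (simp add: pos_le_divide_eq)
  have outer: "normalized_error_set \<epsilon> F \<subseteq> moment_box \<epsilon> (1 / h') G" for \<epsilon>
    using normalized_error_set_subset_moment_box[of F \<epsilon>] \<open>h > 0\<close> assms(7)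
    by (simp add: inv_h' h \<kappa>)
  have inner: "moment_box \<epsilon>' (1 / h) G \<subseteq> normalized_error_set \<epsilon> F"
    if "\<epsilon> > 0" "\<epsilon>' = (1 + \<bar>\<kappa>\<bar>) powi (- 2 * int CARD('n) + 1) * \<epsilon>" for \<epsilon> \<epsilon>'
    using moment_box_subset_normalized_error_set[of F \<epsilon> \<epsilon>'] that \<open>h > 0\<close> assms(7)
    by (simp add: h \<kappa>)
  have near: "normalized_error_set \<epsilon> F
      \<subseteq> closed_neighborhood (C\<^sub>4 * (1 / h') ^ q * \<epsilon>) (prony_variety_part q \<epsilon> (1 / h') G)"
    if "prony_constants TYPE('n) \<eta> m M R C\<^sub>3 C\<^sub>4" "0 < \<epsilon>" "\<epsilon> \<le> R * h' ^ (2 * CARD('n) - 1)"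
      "q \<le> 2 * CARD('n) - 1" for R C\<^sub>3 C\<^sub>4 \<epsilon> q
  proof -
    have "\<epsilon> * (1 / h') ^ (2 * CARD('n) - 1) \<le> R"
      using that(3) \<open>h' > 0\<close> by (simp add: power_one_over pos_divide_le_eq)
    with that show ?thesis
      using outer[of \<epsilon>] moment_box_subset_neighborhood[OF that(1) reg \<open>1 \<le> 1 / h'\<close>, of \<epsilon> q]
      by auto
  qed
  show ?thesis
    by (intro conjI allI impI; (elim conjE)?; (rule inner outer near; assumption))
qed

end
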